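(* Let $X$ be a metrizable Priestley space. Then $X$ is not the dual of a co-Heyting algebra if and only if there are $i\in\{1,2,3\}$, a topological and order embedding $e\colon Z_i^*\to X$, and an open neighborhood $U$ of $e(y)$ such that $e^{-1}({\uparrow}U)=\{x,y\}$.
   Context: For a poset $X$ and $A\subseteq X$, ${\uparrow}A=\{x\in X\mid a\le x\text{ for some }a\in A\}$; $A$ is an upset if ${\uparrow}A=A$. A Priestley space is a compact topological space $X$ with a partial order such that whenever $x\nleq y$ there is a clopen upset $U$ with $x\in U$, $y\notin U$. By Priestley duality, each Priestley space $X$ is the dual of the bounded distributive lattice of its clopen upsets. A co-Heyting algebra is the order-dual of a Heyting algebra; $X$ is the dual of a co-Heyting algebra when its lattice of clopen upsets is a co-Heyting algebra, equivalently, when the upset ${\uparrow}V$ of each open set $V\subseteq X$ is open. The Priestley spaces $Z_1^*,Z_2^*,Z_3^*$ are obtained by reversing the order in the Priestley spaces $Z_1,Z_2,Z_3$, respectively. The latter all have as underlying topological space the one-point compactification of the countable discrete space $\{y\}\cup\{z_n\mid n\in\omega\}$ (all points distinct), where $x$ is the added point. Their orders have exactly the following strict relations. - $Z_1$: $x<y$; $z_0>z_1>z_2>\cdots$; $x<z_n$ for all $n$. - $Z_2$: $x<y$ and $x<z_n$ for all $n$. - $Z_3$: $x<y$ only. *)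

theory Defs
  imports "HOL-Analysis.Analysis" "HOL-Algebra.Lattice"
begin

text \<open>Posets are \<open>HOL-Algebra\<close> orders (\<^typ>\<open>'a gorder\<close>). The order relation of such a structure is
  unconstrained outside the carrier, so upward closures are cut down to the carrier.\<close>

definition upclosure :: "'a gorder \<Rightarrow> 'a set \<Rightarrow> 'a set" where
  "upclosure P A = {x \<in> carrier P. \<exists>a\<in>A. a \<sqsubseteq>\<^bsub>P\<^esub> x}"

definition upset :: "'a gorder \<Rightarrow> 'a set \<Rightarrow> bool" where
  "upset P A \<longleftrightarrow> A \<subseteq> carrier P \<and> upclosure P A = A"

definition clopen_upset :: "'a topology \<Rightarrow> 'a gorder \<Rightarrow> 'a set \<Rightarrow> bool" where
  "clopen_upset X P U \<longleftrightarrow> openin X U \<and> closedin X U \<and> upset P U"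

definition priestley_space :: "'a topology \<Rightarrow> 'a gorder \<Rightarrow> bool" where
  "priestley_space X P \<longleftrightarrow>
     carrier P = topspace X \<and> partial_order P \<and> compact_space X \<and>
     (\<forall>x\<in>topspace X. \<forall>y\<in>topspace X.
        \<not> x \<sqsubseteq>\<^bsub>P\<^esub> y \<longrightarrow> (\<exists>U. clopen_upset X P U \<and> x \<in> U \<and> y \<notin> U))"

text \<open>A Heyting algebra is a bounded lattice with relative pseudocomplements (distributivity follows).\<close>

definition heyting_algebra :: "'a gorder \<Rightarrow> bool" where
  "heyting_algebra L \<longleftrightarrow>
     bounded_lattice L \<and>
     (\<forall>a\<in>carrier L. \<forall>b\<in>carrier L.
        \<exists>c. greatest L c {d \<in> carrier L. a \<sqinter>\<^bsub>L\<^esub> d \<sqsubseteq>\<^bsub>L\<^esub> b})"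

definition co_heyting_algebra :: "'a gorder \<Rightarrow> bool" where
  "co_heyting_algebra L \<longleftrightarrow> heyting_algebra (inv_gorder L)"

definition clopen_upset_lattice :: "'a topology \<Rightarrow> 'a gorder \<Rightarrow> 'a set gorder" where
  "clopen_upset_lattice X P = \<lparr>carrier = {U. clopen_upset X P U}, eq = (=), le = (\<subseteq>)\<rparr>"

definition dual_of_co_heyting_algebra :: "'a topology \<Rightarrow> 'a gorder \<Rightarrow> bool" where
  "dual_of_co_heyting_algebra X P \<longleftrightarrow> co_heyting_algebra (clopen_upset_lattice X P)"

text \<open>The points of the spaces $Z_i$: \<open>Alexandroff_compactification\<close> adds \<^const>\<open>None\<close> as the point at
  infinity, so $x$ is \<^const>\<open>None\<close> and the isolated points $y$ and $z_n$ are \<open>Some PtY\<close> and \<open>Some (PtZ n)\<close>.\<close>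

datatype isolated_pt = PtY | PtZ nat

type_synonym Z_pt = "isolated_pt option"

abbreviation x_pt :: Z_pt where "x_pt \<equiv> None"
abbreviation y_pt :: Z_pt where "y_pt \<equiv> Some PtY"
abbreviation z_pt :: "nat \<Rightarrow> Z_pt" where "z_pt n \<equiv> Some (PtZ n)"

definition Z_topology :: "Z_pt topology" where
  "Z_topology = Alexandroff_compactification (discrete_topology UNIV)"

definition order_of_strict :: "('a \<times> 'a) set \<Rightarrow> 'a gorder" where
  "order_of_strict R = \<lparr>carrier = UNIV, eq = (=), le = (\<lambda>p q. p = q \<or> (p, q) \<in> R)\<rparr>"

definition Z1 :: "Z_pt gorder" where
  "Z1 = order_of_strict
     ({(x_pt, y_pt)} \<union> {(z_pt m, z_pt n) | m n. n < m} \<union> {(x_pt, z_pt n) | n. True})"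

definition Z2 :: "Z_pt gorder" where
  "Z2 = order_of_strict ({(x_pt, y_pt)} \<union> {(x_pt, z_pt n) | n. True})"

definition Z3 :: "Z_pt gorder" where
  "Z3 = order_of_strict {(x_pt, y_pt)}"

end

theory Submission
  imports Defs "HOL-Library.Ramsey"
begin

text \<open>The space is dual to a co-Heyting algebra iff the (always closed) upset generated by each
  difference \<open>V = A - B\<close> of clopen upsets is open. If it is not open, metrizability gives a sequence
  $w_n \to x$ outside the upset with $x$ inside it, say \<open>y \<le> x\<close> for some \<open>y \<in> V\<close>; since \<open>V\<close> is
  open, \<open>y < x\<close>. By Ramsey's theorem we may assume that the order between $w_i$, $w_j$ for \<open>i < j\<close>,
  and whether $w_i \le x$, do not depend on \<open>i, j\<close>. As the order is closed, a descending sequence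
  would force $y \le x \le w_n$, so the sequence is an ascending chain below \<open>x\<close>, an antichain
  below \<open>x\<close>, or an antichain of points incomparable to \<open>x\<close>: these are the three
  spaces. Conversely, the preimage \<open>{x, y}\<close> is not open, because the $z_n$ converge to \<open>x\<close>.\<close>

section \<open>Homogeneous subsequences\<close>

text \<open>Ramsey's theorem yields an infinite homogeneous set for a colouring of two-element sets;
  listing it increasingly gives the subsequence.\<close>

lemma Ramsey_sequence:
  fixes c :: "nat \<Rightarrow> nat \<Rightarrow> 'c::finite"
  obtains r :: "nat \<Rightarrow> nat" and k where "strict_mono r" and "\<And>i j. i < j \<Longrightarrow> c (r i) (r j) = k"
proof -
  obtain h :: "'c \<Rightarrow> nat" where h: "bij_betw h UNIV {0..<card (UNIV :: 'c set)}"
    using ex_bij_betw_finite_nat[OF finite[of UNIV]] by blast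
  \<comment> \<open>\<open>Min\<close> and \<open>Max\<close> recover the pair \<open>i < j\<close>
    from its set, so \<open>c\<close> may be asymmetric; \<open>h\<close> numbers the
    colours.\<close>
  define f where "f = (\<lambda>A. h (c (Min A) (Max A)))"
  have "\<forall>A. A \<subseteq> UNIV \<and> finite A \<and> card A = 2 \<longrightarrow> f A < card (UNIV :: 'c set)"
    using bij_betw_apply[OF h] by (simp add: f_def)
  from Ramsey[OF infinite_UNIV_nat this] obtain Y t
    where Y: "infinite Y" and t: "\<forall>A. A \<subseteq> Y \<and> finite A \<and> card A = 2 \<longrightarrow> f A = t"
    by (elim exE conjE) (rule that)
  have mono: "strict_mono (enumerate Y)"
    using Y by (rule strict_mono_enumerate)
  have hom: "c (enumerate Y i) (enumerate Y j) = inv h t" if "i < j" for i j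
  proof -
    have lt: "enumerate Y i < enumerate Y j"
      using mono that by (simp add: strict_mono_def)
    have "f {enumerate Y i, enumerate Y j} = t"
      using Y less_imp_neq[OF lt] by (intro t[rule_format]) (simp add: enumerate_in_set)
    then have "h (c (enumerate Y i) (enumerate Y j)) = t"
      using lt by (simp add: f_def min_def max_def)
    moreover have "inj h"
      using h by (rule bij_betw_imp_inj_on)
    ultimately show ?thesis
      by (metis inv_f_f)
  qed
  show thesis
    by (rule that[OF mono]) (rule hom)
qed

subsection \<open>Embeddings of the one-point compactification\<close>

lemma closedin_sequentially:
  assumes "metrizable_space X"
  shows "closedin X S \<longleftrightarrow>
    S \<subseteq> topspace X \<and> (\<forall>\<sigma> l. range \<sigma> \<subseteq> S \<and> limitin X \<sigma> l sequentially \<longrightarrow> l \<in> S)"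
  using assms Metric_space.metric_closedin_iff_sequentially_closed Metric_space.topspace_mtopology
  unfolding metrizable_space_def by fastforce

lemma embedding_map_imp_continuous_map: "embedding_map X Y f \<Longrightarrow> continuous_map X Y f"
  by (simp add: embedding_map_def homeomorphic_eq_everything_map continuous_map_in_subtopology)

lemma topspace_Z: "topspace Z_topology = UNIV"
  by (simp add: Z_topology_def UNIV_option_conv)

text \<open>Compact subsets of a discrete space are the finite ones, and every set of isolated
  points is open.\<close>

lemma openin_Z_iff: "openin Z_topology S \<longleftrightarrow> (x_pt \<in> S \<longrightarrow> finite (- S))"
proof
  assume "openin Z_topology S"
  then show "x_pt \<in> S \<longrightarrow> finite (- S)"
    unfolding Z_topology_def openin_Alexandroff_compactification
  proof (elim disjE exE conjE)
    fix C :: "isolated_pt set"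
    assume "compactin (discrete_topology UNIV) C"
      and S: "S = insert None (Some ` (topspace (discrete_topology UNIV) - C))"
    then have "finite C"
      by (simp add: compactin_discrete_topology)
    moreover have "- S = Some ` C"
      unfolding S using not_None_eq by (fastforce simp: image_iff)
    ultimately show ?thesis
      by simp
  qed auto
next
  assume fin: "x_pt \<in> S \<longrightarrow> finite (- S)"
  show "openin Z_topology S"
  proof (cases "x_pt \<in> S")
    case True
    let ?C = "Some -` (- S)"
    have "finite ?C"
      using fin True by (intro finite_vimageI) auto
    moreover have "S = insert None (Some ` (UNIV - ?C))"
      using True not_None_eq by (fastforce simp: image_iff)
    ultimately show ?thesis
      unfolding Z_topology_def openin_Alexandroff_compactification
      by (intro disjI2 exI[of _ ?C]) (auto simp: compactin_discrete_topology)
  next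
    case False
    then have "S = Some ` (Some -` S)"
      using not_None_eq by (fastforce simp: image_iff)
    then show ?thesis
      unfolding Z_topology_def openin_Alexandroff_compactification
      by (intro disjI1 exI[of _ "Some -` S"]) simp
  qed
qed

lemma weak_partial_order_Z:
  "weak_partial_order Z1" "weak_partial_order Z2" "weak_partial_order Z3"
  by (unfold_locales; auto simp: Z1_def Z2_def Z3_def order_of_strict_def)+

text \<open>Meant for a sequence \<open>w\<close> converging to \<open>x\<close>, which makes the
  map continuous at the point at infinity.\<close>

definition Z_map :: "'a \<Rightarrow> 'a \<Rightarrow> (nat \<Rightarrow> 'a) \<Rightarrow> Z_pt \<Rightarrow> 'a" where
  "Z_map x y w p = (case p of None \<Rightarrow> x | Some PtY \<Rightarrow> y | Some (PtZ n) \<Rightarrow> w n)"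

lemma continuous_map_Z_map:
  assumes lim: "limitin X w x sequentially" and "range w \<subseteq> topspace X" "y \<in> topspace X"
  shows "continuous_map Z_topology X (Z_map x y w)"
  unfolding continuous_map_def topspace_Z
proof (intro conjI allI impI)
  show "Z_map x y w \<in> UNIV \<rightarrow> topspace X"
    using assms(2,3) limitin_topspace[OF lim]
    by (auto simp: Z_map_def image_subset_iff split: option.splits isolated_pt.splits)
next
  fix U assume U: "openin X U"
  have "finite (- {p. Z_map x y w p \<in> U})" if "x \<in> U"
  proof -
    have "\<forall>\<^sub>F n in sequentially. w n \<in> U"
      using lim U that by (simp add: limitin_def)
    then have "finite {n. w n \<notin> U}"
      by (simp add: eventually_cofinite flip: cofinite_eq_sequentially)
    \<comment> \<open>Only \<open>y_pt\<close> and the finitely many \<open>z_pt n\<close> with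
      \<open>w n\<close> outside \<open>U\<close> can be mapped outside \<open>U\<close>.\<close>
    then have "finite (insert y_pt (z_pt ` {n. w n \<notin> U}))"
      by simp
    then show ?thesis
      by (rule rev_finite_subset)
        (use that in \<open>auto simp: Z_map_def image_iff split: option.splits isolated_pt.splits\<close>)
  qed
  then show "openin Z_topology {p \<in> UNIV. Z_map x y w p \<in> U}"
    unfolding openin_Z_iff by (simp add: Z_map_def)
qed

text \<open>A continuous map from a compact space to a Hausdorff space is closed, so injectivity is
  all that remains.\<close>

lemma embedding_map_Z_map:
  assumes "Hausdorff_space X" "limitin X w x sequentially"
    and "range w \<subseteq> topspace X" "y \<in> topspace X"
    and "inj w" "x \<notin> range w" "y \<notin> range w" "x \<noteq> y"
  shows "embedding_map Z_topology X (Z_map x y w)"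
proof (rule injective_closed_imp_embedding_map)
  show cont: "continuous_map Z_topology X (Z_map x y w)"
    using assms by (intro continuous_map_Z_map)
  show "closed_map Z_topology X (Z_map x y w)"
    using assms(1) cont
    by (intro continuous_imp_closed_map_gen Hausdorff_imp_kc_space) (simp_all add: Z_topology_def)
  show "inj_on (Z_map x y w) (topspace Z_topology)"
    using assms(5-8)
    by (auto simp: inj_on_def Z_map_def split: option.splits isolated_pt.splits)
qed

subsection \<open>Priestley spaces\<close>

locale priestley =
  fixes X :: "'a topology" and P :: "'a gorder" (structure)
  assumes priestley: "priestley_space X P"
begin

sublocale partial_order P
  using priestley by (simp add: priestley_space_def)

lemma carrier_eq [simp]: "carrier P = topspace X"
  using priestley by (simp add: priestley_space_def)

lemma compact: "compact_space X"
  using priestley by (simp add: priestley_space_def)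

lemma antisym: "p \<sqsubseteq> q \<Longrightarrow> q \<sqsubseteq> p \<Longrightarrow> p \<in> topspace X \<Longrightarrow> q \<in> topspace X \<Longrightarrow> p = q"
  using le_antisym by simp

lemma upclosure_mono: "A \<subseteq> B \<Longrightarrow> upclosure P A \<subseteq> upclosure P B"
  by (auto simp: upclosure_def)

lemma subset_upclosure: "A \<subseteq> topspace X \<Longrightarrow> A \<subseteq> upclosure P A"
  using le_refl unfolding upclosure_def carrier_eq by blast

lemma clopen_upset_iff:
  "clopen_upset X P A \<longleftrightarrow> openin X A \<and> closedin X A \<and>
     (\<forall>p\<in>A. \<forall>q\<in>topspace X. p \<sqsubseteq> q \<longrightarrow> q \<in> A)"
proof -
  have "upset P A \<longleftrightarrow> (\<forall>p\<in>A. \<forall>q\<in>topspace X. p \<sqsubseteq> q \<longrightarrow> q \<in> A)" if "A \<subseteq> topspace X"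
    using subset_upclosure[OF that] that by (auto simp: upset_def upclosure_def)
  then show ?thesis
    using openin_subset[of X A] by (auto simp: clopen_upset_def)
qed

lemma clopen_upset_subset: "clopen_upset X P A \<Longrightarrow> A \<subseteq> topspace X"
  by (simp add: clopen_upset_iff openin_subset)

lemma clopen_upset_mono:
  "clopen_upset X P A \<Longrightarrow> p \<in> A \<Longrightarrow> p \<sqsubseteq> q \<Longrightarrow> q \<in> topspace X \<Longrightarrow> q \<in> A"
  by (simp add: clopen_upset_iff)

lemma clopen_upset_empty: "clopen_upset X P {}"
  by (simp add: clopen_upset_iff)

lemma clopen_upset_topspace: "clopen_upset X P (topspace X)"
  by (simp add: clopen_upset_iff)

lemma clopen_upset_Un: "clopen_upset X P A \<Longrightarrow> clopen_upset X P B \<Longrightarrow> clopen_upset X P (A \<union> B)"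
  by (auto simp: clopen_upset_iff)

lemma clopen_upset_Int: "clopen_upset X P A \<Longrightarrow> clopen_upset X P B \<Longrightarrow> clopen_upset X P (A \<inter> B)"
  by (auto simp: clopen_upset_iff)

section \<open>Separation by clopen upsets\<close>

lemma separation:
  assumes "p \<in> topspace X" "q \<in> topspace X" "\<not> p \<sqsubseteq> q"
  obtains A where "clopen_upset X P A" "p \<in> A" "q \<notin> A"
  using priestley assms unfolding priestley_space_def by metis

text \<open>Each point of \<open>K\<close> lies in a clopen upset missing \<open>q\<close>; by
  compactness finitely many of them cover \<open>K\<close>, and their union is the required
  set.\<close>

lemma clopen_upset_superset:
  assumes K: "closedin X K" and q: "q \<in> topspace X" and nle: "\<And>p. p \<in> K \<Longrightarrow> \<not> p \<sqsubseteq> q"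
  obtains A where "clopen_upset X P A" "K \<subseteq> A" "q \<notin> A"
proof -
  let ?\<U> = "{A. clopen_upset X P A \<and> q \<notin> A}"
  have "compactin X K"
    using compact K by (rule closedin_compact_space)
  moreover have "K \<subseteq> \<Union>?\<U>"
  proof
    fix p assume p: "p \<in> K"
    then have "p \<in> topspace X"
      using closedin_subset[OF K] by blast
    from separation[OF this q nle[OF p]] show "p \<in> \<Union>?\<U>"
      by blast
  qed
  ultimately obtain \<F> where \<F>: "finite \<F>" "\<F> \<subseteq> ?\<U>" "K \<subseteq> \<Union>\<F>"
    using compactinD[of X K ?\<U>] by (auto simp: clopen_upset_iff)
  from \<F>(1,2) have "clopen_upset X P (\<Union>\<F>) \<and> q \<notin> \<Union>\<F>"
    by induction (auto simp: clopen_upset_empty clopen_upset_Un)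
  with \<F>(3) show thesis
    using that by blast
qed

text \<open>A point outside \<open>U\<close> differs from \<open>u\<close>, so by antisymmetry some
  clopen upset contains exactly one of the two. Compactness of the complement of \<open>U\<close>
  leaves finitely many such conditions.\<close>

lemma clopen_upset_difference_basis:
  assumes U: "openin X U" and u: "u \<in> U"
  obtains A B where "clopen_upset X P A" "clopen_upset X P B" "u \<in> A - B" "A - B \<subseteq> U"
proof -
  let ?basic = "\<lambda>A B. clopen_upset X P A \<and> clopen_upset X P B \<and> u \<in> A - B"
  let ?\<U> = "{topspace X - (A - B) | A B. ?basic A B}"
  have uX: "u \<in> topspace X"
    using openin_subset[OF U] u by blast
  have "compactin X (topspace X - U)"
    using compact U by (intro closedin_compact_space) auto
  moreover have "openin X W" if "W \<in> ?\<U>" for W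
    using that by (auto simp: clopen_upset_iff intro!: openin_diff closedin_diff)
  moreover have "topspace X - U \<subseteq> \<Union>?\<U>"
  proof
    fix p assume p: "p \<in> topspace X - U"
    then have "p \<noteq> u" using u by blast
    then consider "\<not> u \<sqsubseteq> p" | "\<not> p \<sqsubseteq> u"
      using antisym p uX by blast
    then show "p \<in> \<Union>?\<U>"
    proof cases
      case 1
      then obtain A where "clopen_upset X P A" "u \<in> A" "p \<notin> A"
        using separation p uX by blast
      \<comment> \<open>One upset suffices to exclude \<open>p\<close>; the other member of the pair
        is trivial, \<open>{}\<close> here and \<open>topspace X\<close> in the second case.\<close>
      then have "?basic A {}" "p \<in> topspace X - (A - {})"
        using p by (auto simp: clopen_upset_empty)
      then show ?thesis by blast
    next
      case 2
      then obtain B where "clopen_upset X P B" "p \<in> B" "u \<notin> B"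
        using separation p uX by blast
      then have "?basic (topspace X) B" "p \<in> topspace X - (topspace X - B)"
        using p uX by (auto simp: clopen_upset_topspace)
      then show ?thesis by blast
    qed
  qed
  ultimately obtain \<F> where \<F>: "finite \<F>" "\<F> \<subseteq> ?\<U>" "topspace X - U \<subseteq> \<Union>\<F>"
    using compactinD[of X "topspace X - U" ?\<U>] by blast
  from \<F>(1,2) have "\<exists>A B. ?basic A B \<and> \<Union>\<F> \<subseteq> topspace X - (A - B)"
  proof induction
    case empty
    then show ?case
      using clopen_upset_empty clopen_upset_topspace uX by blast
  next
    case (insert W \<F>)
    then obtain A B where AB: "?basic A B" "\<Union>\<F> \<subseteq> topspace X - (A - B)"
      by auto
    from insert obtain A' B' where AB': "?basic A' B'" "W = topspace X - (A' - B')"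
      by auto
    \<comment> \<open>The new difference is the intersection of \<open>A - B\<close> and
      \<open>A' - B'\<close>.\<close>
    have "?basic (A \<inter> A') (B \<union> B')"
      using AB AB' clopen_upset_Int clopen_upset_Un by blast
    moreover have "\<Union>(insert W \<F>) \<subseteq> topspace X - (A \<inter> A' - (B \<union> B'))"
      using AB AB' by blast
    ultimately show ?case by blast
  qed
  then obtain A B where "?basic A B" "\<Union>\<F> \<subseteq> topspace X - (A - B)"
    by blast
  moreover from this have "A - B \<subseteq> U"
    using \<F>(3) clopen_upset_subset[of A] by blast
  ultimately show thesis
    using that by blast
qed

text \<open>A point \<open>q\<close> outside the upclosure is missed by a clopen upset that contains
  \<open>K\<close>, hence the upclosure; its complement is a neighbourhood of
  \<open>q\<close>.\<close>

lemma closedin_upclosure: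
  assumes K: "closedin X K"
  shows "closedin X (upclosure P K)"
proof -
  have "openin X (topspace X - upclosure P K)"
  proof (subst openin_subopen, intro ballI)
    fix q assume q: "q \<in> topspace X - upclosure P K"
    then obtain A where A: "clopen_upset X P A" "K \<subseteq> A" "q \<notin> A"
      using clopen_upset_superset[OF K] by (auto simp: upclosure_def)
    then have "openin X (topspace X - A)" "q \<in> topspace X - A"
      using q by (auto simp: clopen_upset_iff)
    moreover have "topspace X - A \<subseteq> topspace X - upclosure P K"
      using A clopen_upset_mono by (auto simp: upclosure_def)
    ultimately show "\<exists>T. openin X T \<and> q \<in> T \<and> T \<subseteq> topspace X - upclosure P K"
      by blast
  qed
  then show ?thesis
    by (auto simp: closedin_def upclosure_def)
qed

lemma upclosure_upward:
  "A \<subseteq> topspace X \<Longrightarrow> p \<in> upclosure P A \<Longrightarrow> p \<sqsubseteq> q \<Longrightarrow> q \<in> topspace X \<Longrightarrow> q \<in> upclosure P A"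
  using le_trans unfolding upclosure_def carrier_eq by blast

section \<open>The co-Heyting condition\<close>

lemma bounded_lattice_dual: "bounded_lattice (inv_gorder (clopen_upset_lattice X P))" (is "bounded_lattice ?L")
proof -
  interpret dual: partial_order ?L
    by unfold_locales (auto simp: clopen_upset_lattice_def)
  show ?thesis
  proof unfold_locales
    fix A B assume "A \<in> carrier ?L" "B \<in> carrier ?L"
    \<comment> \<open>Inclusion is reversed, so joins are intersections and meets are
      unions.\<close>
    then have "least ?L (A \<inter> B) (Upper ?L {A, B})" "greatest ?L (A \<union> B) (Lower ?L {A, B})"
      by (auto simp: clopen_upset_lattice_def least_def greatest_def Upper_def Lower_def
          clopen_upset_Int clopen_upset_Un)
    then show "\<exists>S. least ?L S (Upper ?L {A, B})" "\<exists>S. greatest ?L S (Lower ?L {A, B})"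
      by blast+
  next
    have "least ?L (topspace X) (carrier ?L)" "greatest ?L {} (carrier ?L)"
      by (auto simp: clopen_upset_lattice_def least_def greatest_def
          clopen_upset_topspace clopen_upset_empty dest: clopen_upset_subset)
    then show "\<exists>S. least ?L S (carrier ?L)" "\<exists>S. greatest ?L S (carrier ?L)"
      by blast+
  qed
qed

lemma meet_dual:
  assumes "clopen_upset X P A" "clopen_upset X P B"
  shows "A \<sqinter>\<^bsub>inv_gorder (clopen_upset_lattice X P)\<^esub> B = A \<union> B"
proof -
  have Upper: "Upper (clopen_upset_lattice X P) {A, B} = {C. clopen_upset X P C \<and> A \<union> B \<subseteq> C}"
    using assms by (auto simp: clopen_upset_lattice_def Upper_def)
  \<comment> \<open>\<open>inf\<close> selects some greatest lower bound, so uniqueness is needed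
    besides existence; in the reversed order it is a least upper bound.\<close>
  have "least (clopen_upset_lattice X P) C (Upper (clopen_upset_lattice X P) {A, B}) \<longleftrightarrow> C = A \<union> B" for C
    unfolding Upper using clopen_upset_Un[OF assms]
    by (simp add: clopen_upset_lattice_def least_def) blast
  then show ?thesis
    by (simp add: meet_def Lattice.inf_def)
qed

text \<open>Under reversed inclusion the inequality defining a relative pseudocomplement reads
  \<open>B \<subseteq> A \<union> D\<close>, that is \<open>B - A \<subseteq> D\<close>, and
  greatest means smallest.\<close>

lemma dual_of_co_heyting_algebra_iff_least:
  "dual_of_co_heyting_algebra X P \<longleftrightarrow>
    (\<forall>A B. clopen_upset X P A \<and> clopen_upset X P B \<longrightarrow>
      (\<exists>C. clopen_upset X P C \<and> A - B \<subseteq> C \<and>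
        (\<forall>D. clopen_upset X P D \<and> A - B \<subseteq> D \<longrightarrow> C \<subseteq> D)))"
proof -
  let ?L = "inv_gorder (clopen_upset_lattice X P)"
  have carrier: "A \<in> carrier ?L \<longleftrightarrow> clopen_upset X P A" for A
    by (simp add: clopen_upset_lattice_def)
  have le: "A \<sqsubseteq>\<^bsub>?L\<^esub> B \<longleftrightarrow> B \<subseteq> A" for A B
    by (simp add: clopen_upset_lattice_def)
  have "greatest ?L C {D \<in> carrier ?L. A \<sqinter>\<^bsub>?L\<^esub> D \<sqsubseteq>\<^bsub>?L\<^esub> B} \<longleftrightarrow>
      clopen_upset X P C \<and> B - A \<subseteq> C \<and> (\<forall>D. clopen_upset X P D \<and> B - A \<subseteq> D \<longrightarrow> C \<subseteq> D)"
    if A: "clopen_upset X P A" for A B C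
  proof -
    have "{D \<in> carrier ?L. A \<sqinter>\<^bsub>?L\<^esub> D \<sqsubseteq>\<^bsub>?L\<^esub> B} = {D. clopen_upset X P D \<and> B - A \<subseteq> D}"
      unfolding carrier le using meet_dual[OF A] by (auto simp only: Diff_subset_conv)
    then show ?thesis
      unfolding greatest_def le by (auto simp: carrier)
  qed
  then show ?thesis
    unfolding dual_of_co_heyting_algebra_def co_heyting_algebra_def heyting_algebra_def Ball_def carrier
    using bounded_lattice_dual by (auto simp only:)
qed

text \<open>The closed set \<open>A - B\<close> has as upclosure the intersection of all clopen
  upsets containing it. A least such upset must equal this intersection, which is always a closed
  upset, so only openness is at stake.\<close>

lemma dual_of_co_heyting_algebra_iff:
  "dual_of_co_heyting_algebra X P \<longleftrightarrow>
    (\<forall>A B. clopen_upset X P A \<and> clopen_upset X P B \<longrightarrow> openin X (upclosure P (A - B)))"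
proof -
  have "(\<exists>C. clopen_upset X P C \<and> A - B \<subseteq> C \<and>
        (\<forall>D. clopen_upset X P D \<and> A - B \<subseteq> D \<longrightarrow> C \<subseteq> D)) \<longleftrightarrow> openin X (upclosure P (A - B))"
    (is "?L \<longleftrightarrow> ?R")
    if AB: "clopen_upset X P A" "clopen_upset X P B" for A B
  proof -
    have closed: "closedin X (A - B)"
      using AB by (auto simp: clopen_upset_iff)
    then have sub: "A - B \<subseteq> topspace X"
      by (rule closedin_subset)
    show ?thesis
    proof
      assume ?L
      then obtain C where C: "clopen_upset X P C" "A - B \<subseteq> C"
        and least: "\<And>D. clopen_upset X P D \<Longrightarrow> A - B \<subseteq> D \<Longrightarrow> C \<subseteq> D"
        by blast
      have "C \<subseteq> upclosure P (A - B)"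
      proof
        fix q assume q: "q \<in> C"
        show "q \<in> upclosure P (A - B)"
        proof (rule ccontr)
          assume "q \<notin> upclosure P (A - B)"
          then obtain D where "clopen_upset X P D" "A - B \<subseteq> D" "q \<notin> D"
            using clopen_upset_superset[OF closed, of q] clopen_upset_subset[OF C(1)] q
            by (auto simp: upclosure_def)
          with least q show False by blast
        qed
      qed
      moreover have "upclosure P (A - B) \<subseteq> C"
        using C clopen_upset_mono by (auto simp: upclosure_def)
      ultimately show ?R
        using C by (simp add: clopen_upset_iff)
    next
      assume ?R
      then have "clopen_upset X P (upclosure P (A - B))"
        using closedin_upclosure[OF closed] upclosure_upward[OF sub] by (auto simp: clopen_upset_iff)
      moreover have "upclosure P (A - B) \<subseteq> D" if "clopen_upset X P D" "A - B \<subseteq> D" for D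
        using that clopen_upset_mono by (auto simp: upclosure_def)
      ultimately show ?L
        using subset_upclosure[OF sub] by blast
    qed
  qed
  then show ?thesis
    unfolding dual_of_co_heyting_algebra_iff_least by blast
qed

text \<open>Differences of clopen upsets form a basis, and a point above \<open>u\<close> is above
  any basic neighbourhood of \<open>u\<close> inside \<open>U\<close>.\<close>

lemma openin_upclosure:
  assumes "dual_of_co_heyting_algebra X P" "openin X U"
  shows "openin X (upclosure P U)"
proof (subst openin_subopen, intro ballI)
  fix q assume "q \<in> upclosure P U"
  then obtain u where u: "u \<in> U" "u \<sqsubseteq> q" "q \<in> topspace X"
    by (auto simp: upclosure_def)
  then obtain A B where AB: "clopen_upset X P A" "clopen_upset X P B" "u \<in> A - B" "A - B \<subseteq> U"
    using clopen_upset_difference_basis assms(2) by blast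
  then have "openin X (upclosure P (A - B))" "q \<in> upclosure P (A - B)"
    using assms(1) u by (auto simp: dual_of_co_heyting_algebra_iff upclosure_def)
  then show "\<exists>T. openin X T \<and> q \<in> T \<and> T \<subseteq> upclosure P U"
    using upclosure_mono[OF AB(4)] by blast
qed

section \<open>Limits of sequences and the order\<close>

text \<open>A clopen upset around \<open>x\<close> missing \<open>q\<close> eventually contains
  \<open>w n\<close>, so a single later \<open>w n\<close> below \<open>q\<close> is a
  contradiction; hence frequent comparability suffices.\<close>

lemma limit_le:
  assumes lim: "limitin X w x sequentially" and q: "q \<in> topspace X"
    and le: "\<exists>\<^sub>F n in sequentially. w n \<sqsubseteq> q"
  shows "x \<sqsubseteq> q"
proof (rule ccontr)
  assume "\<not> x \<sqsubseteq> q"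
  then obtain A where A: "clopen_upset X P A" "x \<in> A" "q \<notin> A"
    using separation lim q by (metis limitin_topspace)
  then have "\<forall>\<^sub>F n in sequentially. w n \<in> A"
    using lim by (auto simp: limitin_def clopen_upset_iff)
  from frequently_ex[OF frequently_eventually_conj[OF le this]]
  obtain n where "w n \<in> A" "w n \<sqsubseteq> q"
    by blast
  then show False
    using A q clopen_upset_mono by blast
qed

lemma le_limit:
  assumes lim: "limitin X w x sequentially" and q: "q \<in> topspace X"
    and le: "\<exists>\<^sub>F n in sequentially. q \<sqsubseteq> w n"
  shows "q \<sqsubseteq> x"
proof (rule ccontr)
  assume "\<not> q \<sqsubseteq> x"
  then obtain A where A: "clopen_upset X P A" "q \<in> A" "x \<notin> A"
    using separation lim q by (metis limitin_topspace)
  then have "openin X (topspace X - A)" "x \<in> topspace X - A"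
    using lim by (auto simp: clopen_upset_iff limitin_def)
  then have "\<forall>\<^sub>F n in sequentially. w n \<in> topspace X - A"
    using lim unfolding limitin_def by blast
  from frequently_ex[OF frequently_eventually_conj[OF le this]]
  obtain n where "w n \<in> topspace X - A" "q \<sqsubseteq> w n"
    by blast
  then show False
    using A clopen_upset_mono by blast
qed

text \<open>The three reversed orders share every comparison involving \<open>y\<close>, and never
  put \<open>x\<close> below a \<open>z_pt n\<close>. They differ only in the order among the
  \<open>z_pt n\<close> and in whether these lie below \<open>x\<close>.\<close>

lemma order_emb_Z_map:
  assumes pts: "x \<in> topspace X" "y \<in> topspace X" "range w \<subseteq> topspace X"
    and y: "y \<sqsubseteq> x" "\<not> x \<sqsubseteq> y"
    and w: "\<And>n. \<not> x \<sqsubseteq> w n" "\<And>n. \<not> y \<sqsubseteq> w n" "\<And>n. \<not> w n \<sqsubseteq> y"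
  shows "(\<And>n. w n \<sqsubseteq> x) \<Longrightarrow> (\<And>m n. w m \<sqsubseteq> w n \<longleftrightarrow> m \<le> n) \<Longrightarrow>
      order_emb (inv_gorder Z1) P (Z_map x y w)"
    and "(\<And>n. w n \<sqsubseteq> x) \<Longrightarrow> (\<And>m n. w m \<sqsubseteq> w n \<longleftrightarrow> m = n) \<Longrightarrow>
      order_emb (inv_gorder Z2) P (Z_map x y w)"
    and "(\<And>n. \<not> w n \<sqsubseteq> x) \<Longrightarrow> (\<And>m n. w m \<sqsubseteq> w n \<longleftrightarrow> m = n) \<Longrightarrow>
      order_emb (inv_gorder Z3) P (Z_map x y w)"
proof -
  note refl = le_refl[unfolded carrier_eq, OF pts(1)] le_refl[unfolded carrier_eq, OF pts(2)]
  note simps = Z_map_def Z1_def Z2_def Z3_def order_of_strict_def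
  note wpo = weak_partial_order_axioms
  show "order_emb (inv_gorder Z1) P (Z_map x y w)"
    if "\<And>n. w n \<sqsubseteq> x" "\<And>m n. w m \<sqsubseteq> w n \<longleftrightarrow> m \<le> n"
    unfolding order_emb_def
    using that y w refl wpo weak_partial_order_Z(1)[THEN weak_partial_order.dual_weak_order]
    by (auto simp: simps split: option.splits isolated_pt.splits)
  show "order_emb (inv_gorder Z2) P (Z_map x y w)"
    if "\<And>n. w n \<sqsubseteq> x" "\<And>m n. w m \<sqsubseteq> w n \<longleftrightarrow> m = n"
    unfolding order_emb_def
    using that y w refl wpo weak_partial_order_Z(2)[THEN weak_partial_order.dual_weak_order]
    by (auto simp: simps split: option.splits isolated_pt.splits)
  show "order_emb (inv_gorder Z3) P (Z_map x y w)"
    if "\<And>n. \<not> w n \<sqsubseteq> x" "\<And>m n. w m \<sqsubseteq> w n \<longleftrightarrow> m = n"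
    unfolding order_emb_def
    using that y w refl wpo weak_partial_order_Z(3)[THEN weak_partial_order.dual_weak_order]
    by (auto simp: simps split: option.splits isolated_pt.splits)
qed

text \<open>Ramsey's theorem makes the comparisons uniform. Convergence rules out descending chains,
  and it forces ascending ones below \<open>x\<close>, which leaves three patterns.\<close>

lemma homogeneous_subsequence:
  assumes lim: "limitin X w x sequentially" and w: "range w \<subseteq> topspace X" "\<And>n. \<not> x \<sqsubseteq> w n"
  obtains r :: "nat \<Rightarrow> nat" where "strict_mono r" "\<And>n. w (r n) \<sqsubseteq> x" "\<And>m n. w (r m) \<sqsubseteq> w (r n) \<longleftrightarrow> m \<le> n"
    | r :: "nat \<Rightarrow> nat" where "strict_mono r" "\<And>n. w (r n) \<sqsubseteq> x" "\<And>m n. w (r m) \<sqsubseteq> w (r n) \<longleftrightarrow> m = n"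
    | r :: "nat \<Rightarrow> nat" where "strict_mono r" "\<And>n. \<not> w (r n) \<sqsubseteq> x" "\<And>m n. w (r m) \<sqsubseteq> w (r n) \<longleftrightarrow> m = n"
proof -
  \<comment> \<open>The last component depends on \<open>i\<close> alone; pairing \<open>i\<close>
    with \<open>Suc i\<close> later shows that it too is constant along the subsequence.\<close>
  define c where "c i j = (w i \<sqsubseteq> w j, w j \<sqsubseteq> w i, w i \<sqsubseteq> x)" for i j
  obtain r :: "nat \<Rightarrow> nat" and k where r: "strict_mono r"
    and k: "\<And>i j. i < j \<Longrightarrow> c (r i) (r j) = k"
    by (rule Ramsey_sequence[of c]) blast
  obtain up down below where [simp]: "k = (up, down, below)"
    by (cases k)
  have up: "w (r i) \<sqsubseteq> w (r j) \<longleftrightarrow> up" and down: "w (r j) \<sqsubseteq> w (r i) \<longleftrightarrow> down"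
    if "i < j" for i j
    using k[OF that] by (simp_all add: c_def)
  have below: "w (r i) \<sqsubseteq> x \<longleftrightarrow> below" for i
    using k[of i "Suc i"] by (simp add: c_def)
  have wX: "w n \<in> topspace X" for n
    using w(1) by blast
  have refl: "w n \<sqsubseteq> w n" for n
    using le_refl wX by simp
  have lim': "limitin X (w \<circ> r) x sequentially"
    using r lim by (rule limitin_subsequence)
  \<comment> \<open>Otherwise all later terms lie below \<open>w (r 0)\<close>, and so does their
    limit \<open>x\<close>, contrary to the assumption on \<open>w\<close>.\<close>
  have "\<not> down"
  proof
    assume down
    then have "\<forall>\<^sub>F n in sequentially. (w \<circ> r) n \<sqsubseteq> w (r 0)"
      using down by (intro eventually_sequentiallyI[of 1]) simp
    then show False
      using limit_le[OF lim' wX] w(2) eventually_frequently[OF sequentially_bot] by blast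
  qed
  have le_iff: "w (r m) \<sqsubseteq> w (r n) \<longleftrightarrow> m = n \<or> m < n \<and> up" for m n
    using up down[of n m] \<open>\<not> down\<close> refl by (cases m n rule: linorder_cases) auto
  show thesis
  proof (cases up)
    case True
    then have "\<forall>\<^sub>F n in sequentially. w (r 0) \<sqsubseteq> (w \<circ> r) n"
      using up by (intro eventually_sequentiallyI[of 1]) simp
    then have below
      using le_limit[OF lim' wX] below[of 0] eventually_frequently[OF sequentially_bot] by blast
    with True show thesis
      using that(1)[OF r] le_iff below by (auto simp: le_less)
  next
    case False
    then show thesis
      using that(2,3)[OF r] le_iff below by (cases below) auto
  qed
qed

section \<open>Copies of the three spaces\<close>

text \<open>\<open>V\<close> itself serves as the neighbourhood: its upclosure contains
  \<open>y\<close> and \<open>x\<close> but no term of the sequence, so the preimage comes out as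
  required.\<close>

lemma Z_embedding:
  assumes met: "metrizable_space X" and V: "openin X V" "\<not> openin X (upclosure P V)"
  shows "\<exists>Q \<in> {Z1, Z2, Z3}. \<exists>e. embedding_map Z_topology X e \<and> order_emb (inv_gorder Q) P e \<and>
    e y_pt \<in> V \<and> {p. e p \<in> upclosure P V} = {x_pt, y_pt}"
proof -
  have V_sub: "V \<subseteq> topspace X"
    using V(1) by (rule openin_subset)
  have "\<not> closedin X (topspace X - upclosure P V)"
    using V(2) by (auto simp: closedin_def upclosure_def double_diff)
  then obtain w x where w_out: "range w \<subseteq> topspace X - upclosure P V"
    and lim: "limitin X w x sequentially" and x_out: "x \<notin> topspace X - upclosure P V"
    unfolding closedin_sequentially[OF met] by (meson Diff_subset)
  have xX: "x \<in> topspace X"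
    using lim by (rule limitin_topspace)
  then have x: "x \<in> upclosure P V"
    using x_out by blast
  obtain y where y: "y \<in> V" "y \<sqsubseteq> x"
    using x by (auto simp: upclosure_def)
  then have yX: "y \<in> topspace X"
    using V_sub by blast
  have "x \<notin> V"
  proof
    assume "x \<in> V"
    then have "\<forall>\<^sub>F n in sequentially. w n \<in> V"
      using lim V(1) by (auto simp: limitin_def)
    then obtain n where "w n \<in> V"
      by (auto simp: eventually_sequentially)
    then show False
      using w_out subset_upclosure[OF V_sub] by blast
  qed
  then have not_xy: "\<not> x \<sqsubseteq> y"
    using antisym[OF _ y(2) xX yX] y(1) by blast
  \<comment> \<open>Terms frequently below \<open>y\<close> would put \<open>x\<close> below
    \<open>y\<close>; hence only an initial segment, of length \<open>N\<close>, has to be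
    dropped.\<close>
  then have "\<not> (\<exists>\<^sub>F n in sequentially. w n \<sqsubseteq> y)"
    using limit_le[OF lim yX] by blast
  then obtain N where N: "\<And>n. n \<ge> N \<Longrightarrow> \<not> w n \<sqsubseteq> y"
    by (auto simp: not_frequently eventually_sequentially)
  define w' where "w' = (\<lambda>n. w (n + N))"
  have lim': "limitin X w' x sequentially"
    unfolding w'_def using lim by (rule limitin_sequentially_offset)
  have w': "w' n \<in> topspace X" "w' n \<notin> upclosure P V" "\<not> w' n \<sqsubseteq> y" for n
    using w_out N by (auto simp: w'_def)
  \<comment> \<open>The upclosure of \<open>V\<close> contains \<open>x\<close>, hence everything
    above \<open>x\<close>, while the sequence avoids it.\<close>
  then have not_xw: "\<not> x \<sqsubseteq> w' n" for n
    using upclosure_upward[OF V_sub x] by blast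
  have not_yw: "\<not> y \<sqsubseteq> w' n" for n
    using w' y(1) by (auto simp: upclosure_def)
  have y_up: "y \<in> upclosure P V"
    using subset_upclosure[OF V_sub] y(1) by blast
  \<comment> \<open>Common to the three cases. The assumption \<open>inj\<close> holds for chains
    and antichains alike; with reflexivity it makes \<open>w' \<circ> r\<close> injective.\<close>
  have main: "\<exists>e. embedding_map Z_topology X e \<and> order_emb (inv_gorder Q) P e \<and>
      e y_pt \<in> V \<and> {p. e p \<in> upclosure P V} = {x_pt, y_pt}"
    if r: "strict_mono r" and inj: "\<And>m n. w' (r m) \<sqsubseteq> w' (r n) \<Longrightarrow> w' (r n) \<sqsubseteq> w' (r m) \<Longrightarrow> m = n"
      and emb: "order_emb (inv_gorder Q) P (Z_map x y (w' \<circ> r))" for r Q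
  proof (intro exI conjI)
    show "embedding_map Z_topology X (Z_map x y (w' \<circ> r))"
    proof (rule embedding_map_Z_map)
      show "Hausdorff_space X"
        using met by (rule metrizable_imp_Hausdorff_space)
      show "limitin X (w' \<circ> r) x sequentially"
        using r lim' by (rule limitin_subsequence)
      show "inj (w' \<circ> r)"
        using inj w'(1) le_refl by (intro injI) (metis carrier_eq comp_apply)
      show "x \<notin> range (w' \<circ> r)" "y \<notin> range (w' \<circ> r)"
        using x y_up w'(2) by auto
      show "x \<noteq> y"
        using \<open>x \<notin> V\<close> y(1) by blast
    qed (use yX w' in auto)
    show "order_emb (inv_gorder Q) P (Z_map x y (w' \<circ> r))"
      by (rule emb)
    show "Z_map x y (w' \<circ> r) y_pt \<in> V"
      using y(1) by (simp add: Z_map_def)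
    show "{p. Z_map x y (w' \<circ> r) p \<in> upclosure P V} = {x_pt, y_pt}"
      using x y_up w'(2)
      by (auto simp: Z_map_def split: option.splits isolated_pt.splits) (metis isolated_pt.exhaust)
  qed
  have "range w' \<subseteq> topspace X"
    using w'(1) by blast
  from lim' this not_xw show ?thesis
  proof (cases rule: homogeneous_subsequence)
    case (1 r)
    have "order_emb (inv_gorder Z1) P (Z_map x y (w' \<circ> r))"
      using xX yX y(2) not_xy not_xw not_yw w' 1 by (intro order_emb_Z_map) auto
    with main[OF 1(1)] 1 show ?thesis
      by auto
  next
    case (2 r)
    have "order_emb (inv_gorder Z2) P (Z_map x y (w' \<circ> r))"
      using xX yX y(2) not_xy not_xw not_yw w' 2 by (intro order_emb_Z_map) auto
    with main[OF 2(1)] 2 show ?thesis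
      by auto
  next
    case (3 r)
    have "order_emb (inv_gorder Z3) P (Z_map x y (w' \<circ> r))"
      using xX yX y(2) not_xy not_xw not_yw w' 3 by (intro order_emb_Z_map) auto
    with main[OF 3(1)] 3 show ?thesis
      by auto
  qed
qed

end

section \<open>The characterization\<close>

theorem corollary3p6:
  fixes X :: "'a topology" and P :: "'a gorder"
  assumes "priestley_space X P" and "metrizable_space X"
  shows "\<not> dual_of_co_heyting_algebra X P \<longleftrightarrow>
    (\<exists>Q \<in> {Z1, Z2, Z3}. \<exists>e U.
       embedding_map Z_topology X e \<and> order_emb (inv_gorder Q) P e \<and>
       openin X U \<and> e y_pt \<in> U \<and>
       {p \<in> topspace Z_topology. e p \<in> upclosure P U} = {x_pt, y_pt})"
    (is "?L \<longleftrightarrow> ?R")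
proof -
  interpret priestley X P
    by unfold_locales (rule assms(1))
  show ?thesis
  proof
    assume ?L
    then obtain A B where AB: "clopen_upset X P A" "clopen_upset X P B"
      "\<not> openin X (upclosure P (A - B))"
      by (auto simp: dual_of_co_heyting_algebra_iff)
    \<comment> \<open>A difference of clopen sets is open, so it can play the role of
      \<open>V\<close>.\<close>
    then have "openin X (A - B)"
      by (auto simp: clopen_upset_iff)
    with Z_embedding[OF assms(2) this AB(3)] show ?R
      unfolding topspace_Z by fastforce
  next
    assume ?R
    then obtain e U where e: "embedding_map Z_topology X e" and U: "openin X U"
      and pre: "{p \<in> topspace Z_topology. e p \<in> upclosure P U} = {x_pt, y_pt}"
      by blast
    show ?L
    proof
      assume "dual_of_co_heyting_algebra X P"
      then have "openin X (upclosure P U)"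
        using U by (rule openin_upclosure)
      \<comment> \<open>The preimage of an open set would be open and contain \<open>x_pt\<close>,
        hence be cofinite, yet it omits every \<open>z_pt n\<close>.\<close>
      then have "openin Z_topology {x_pt, y_pt}"
        using openin_continuous_map_preimage[OF embedding_map_imp_continuous_map[OF e]] pre by metis
      then have "finite (- {x_pt, y_pt})"
        by (simp add: openin_Z_iff)
      then have "finite (range z_pt)"
        by (rule rev_finite_subset) auto
      then show False
        by (simp add: finite_image_iff inj_def)
    qed
  qed
qed

end
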